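(* (Projection Theorem) Let $G\in\mathbb{GS}$ and $n=b(G)$. Then (1) $G_{min}\preccurlyeq G\preccurlyeq G_{max}$; (2) $min(G)-\widehat n\preccurlyeq G\preccurlyeq max(G)+\widehat n$; (3) $b(min(G)-\widehat n)=b(max(G)+\widehat n)=n$.
   Context: A scoring game is written $G=\langle G^{\mathcal L}\mid G^{\mathcal R}\rangle$, where each of $G^{\mathcal L}$ (Left options) and $G^{\mathcal R}$ (Right options) is either a finite nonempty set of scoring games or an atom $\emptyset^{s}$, $s\in\mathbb R$ (the player to move on that side cannot move and the game ends with score $s$); game trees are finite. An atom occurring in $G$ is an atom of $G$ or of any follower of $G$. $G$ is guaranteed if for every follower $K$ of $G$: if $K^{\mathcal L}=\emptyset^\ell$ then $\ell\le s$ for every atom $\emptyset^s$ occurring in $K$, and if $K^{\mathcal R}=\emptyset^r$ then $s\le r$ for every atom $\emptyset^s$ occurring in $K$; $\mathbb{GS}$ is the class of guaranteed games. The birthday $b(G)$ is $0$ if both sides of $G$ are atoms, and otherwise $1+$ the maximum birthday of the options of $G$ (the depth of the game tree). Disjunctive sum $G+H$: Left options are $G^L+H$ and $G+H^L$, except if both are left-atomic with atoms $\emptyset^{\ell_1},\emptyset^{\ell_2}$, then $(G+H)^{\mathcal L}=\emptyset^{\ell_1+\ell_2}$; Right symmetric. Stops: $Ls(G)=\ell$ if $G^{\mathcal L}=\emptyset^\ell$, otherwise $\max_{G^L}Rs(G^L)$; $Rs(G)=r$ if $G^{\mathcal R}=\emptyset^r$, otherwise $\min_{G^R}Ls(G^R)$.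 $G\succcurlyeq H$ iff $Ls(G+X)\ge Ls(H+X)$ and $Rs(G+X)\ge Rs(H+X)$ for all $X\in\mathbb{GS}$; $G\preccurlyeq H$ means $H\succcurlyeq G$. A real number $x$ denotes the game $\langle\emptyset^x\mid\emptyset^x\rangle$. Conjugate: $\overleftrightarrow{G}=\langle\overleftrightarrow{G^{\mathcal R}}\mid\overleftrightarrow{G^{\mathcal L}}\rangle$ (conjugate each option; atom $\emptyset^s$ becomes $\emptyset^{-s}$). Waiting moves: $\widehat 0=0$, $\widehat{k+1}=\langle\widehat k\mid\emptyset^0\rangle$ for integers $k\ge0$, and $-\widehat k=\overleftrightarrow{\widehat k}$; $x\pm\widehat k$ are disjunctive sums. For $G\in\mathbb{GS}$, $G_x$ is $G$ with every atom replaced by $\emptyset^x$; $min(G)$ and $max(G)$ are the minimum and maximum of $s$ over atoms $\emptyset^s$ occurring in $G$; $G_{min}=G_{min(G)}$, $G_{max}=G_{max(G)}$. *)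

theory Defs
  imports Complex_Main "HOL-Library.FSet"
begin

text \<open>One side of a game is an atom or a finite set of options. The datatype also contains sides
  with an empty set of options; such games are excluded by \<open>well_formed\<close>, which is part of
  the definition of \<open>GS\<close>.\<close>

datatype 'g side = Atom real | Options "'g fset"

datatype game = Game (lside: "game side") (rside: "game side")

fun opts :: "'g side \<Rightarrow> 'g fset" where
  "opts (Atom s) = {||}"
| "opts (Options A) = A"

definition lopts :: "game \<Rightarrow> game fset" where
  "lopts G = opts (lside G)"

definition ropts :: "game \<Rightarrow> game fset" where
  "ropts G = opts (rside G)"

lemma size_fset_member: "x |\<in>| A \<Longrightarrow> size x < size_fset size A"
  by (simp add: size_fset_simps sum.remove[of "fset A" x])

lemma size_opts: "x |\<in>| opts S \<Longrightarrow> size x < size_side size S"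
  by (cases S) (auto dest: size_fset_member)

lemma size_lopts [termination_simp]: "x |\<in>| lopts G \<Longrightarrow> size x < size G"
  by (cases G) (auto simp: lopts_def dest: size_opts)

lemma size_ropts [termination_simp]: "x |\<in>| ropts G \<Longrightarrow> size x < size G"
  by (cases G) (auto simp: ropts_def dest: size_opts)

text \<open>Followers of a game include the game itself.\<close>

inductive follower :: "game \<Rightarrow> game \<Rightarrow> bool" for G :: game where
  follower_refl: "follower G G"
| follower_left: "follower G K \<Longrightarrow> H |\<in>| lopts K \<Longrightarrow> follower G H"
| follower_right: "follower G K \<Longrightarrow> H |\<in>| ropts K \<Longrightarrow> follower G H"

definition well_formed :: "game \<Rightarrow> bool" where
  "well_formed G \<longleftrightarrow>
    (\<forall>K. follower G K \<longrightarrow> lside K \<noteq> Options {||} \<and> rside K \<noteq> Options {||})"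

definition atoms :: "game \<Rightarrow> real set" where
  "atoms G = {s. \<exists>K. follower G K \<and> (lside K = Atom s \<or> rside K = Atom s)}"

definition guaranteed :: "game \<Rightarrow> bool" where
  "guaranteed G \<longleftrightarrow> (\<forall>K. follower G K \<longrightarrow>
    (\<forall>l. lside K = Atom l \<longrightarrow> (\<forall>s\<in>atoms K. l \<le> s)) \<and>
    (\<forall>r. rside K = Atom r \<longrightarrow> (\<forall>s\<in>atoms K. s \<le> r)))"

definition GS :: "game set" where
  "GS = {G. well_formed G \<and> guaranteed G}"

fun birthday :: "game \<Rightarrow> nat" where
  "birthday G =
    (if (\<exists>l r. G = Game (Atom l) (Atom r)) then 0
     else 1 + Max (birthday ` (fset (lopts G) \<union> fset (ropts G))))"

function game_add :: "game \<Rightarrow> game \<Rightarrow> game" (infixl \<open>\<oplus>\<close> 65) where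
  "G \<oplus> H = Game
    (case (lside G, lside H) of
       (Atom a, Atom b) \<Rightarrow> Atom (a + b)
     | _ \<Rightarrow> Options ((\<lambda>K. K \<oplus> H) |`| lopts G |\<union>| (\<lambda>K. G \<oplus> K) |`| lopts H))
    (case (rside G, rside H) of
       (Atom a, Atom b) \<Rightarrow> Atom (a + b)
     | _ \<Rightarrow> Options ((\<lambda>K. K \<oplus> H) |`| ropts G |\<union>| (\<lambda>K. G \<oplus> K) |`| ropts H))"
  by pat_completeness auto
termination
  by (relation "measure (\<lambda>(G, H). size G + size H)") (auto dest: size_lopts size_ropts)

function Ls :: "game \<Rightarrow> real" and Rs :: "game \<Rightarrow> real" where
  "Ls G = (case lside G of Atom l \<Rightarrow> l | Options A \<Rightarrow> Max (Rs ` fset (lopts G)))"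
| "Rs G = (case rside G of Atom r \<Rightarrow> r | Options A \<Rightarrow> Min (Ls ` fset (ropts G)))"
  by pat_completeness auto
termination
  by (relation "measure (\<lambda>x. case x of Inl G \<Rightarrow> size G | Inr G \<Rightarrow> size G)")
    (auto dest: size_lopts size_ropts)

text \<open>These equations loop as rewrite rules.\<close>

declare birthday.simps [simp del] game_add.simps [simp del] Ls.simps [simp del] Rs.simps [simp del]

definition game_ge :: "game \<Rightarrow> game \<Rightarrow> bool" (infix \<open>\<succeq>\<close> 50) where
  "G \<succeq> H \<longleftrightarrow> (\<forall>X\<in>GS. Ls (G \<oplus> X) \<ge> Ls (H \<oplus> X) \<and> Rs (G \<oplus> X) \<ge> Rs (H \<oplus> X))"

abbreviation game_le :: "game \<Rightarrow> game \<Rightarrow> bool" (infix \<open>\<preceq>\<close> 50) where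
  "G \<preceq> H \<equiv> H \<succeq> G"

definition number :: "real \<Rightarrow> game" where
  "number x = Game (Atom x) (Atom x)"

fun map_atom :: "(real \<Rightarrow> real) \<Rightarrow> 'g side \<Rightarrow> 'g side" where
  "map_atom f (Atom s) = Atom (f s)"
| "map_atom f (Options A) = Options A"

primrec conjugate :: "game \<Rightarrow> game" where
  "conjugate (Game L R) =
    Game (map_atom uminus (map_side conjugate R)) (map_atom uminus (map_side conjugate L))"

primrec waiting :: "nat \<Rightarrow> game" where
  "waiting 0 = number 0"
| "waiting (Suc k) = Game (Options {|waiting k|}) (Atom 0)"

primrec replace_atoms :: "real \<Rightarrow> game \<Rightarrow> game" where
  "replace_atoms x (Game L R) =
    Game (map_atom (\<lambda>_. x) (map_side (replace_atoms x) L))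
         (map_atom (\<lambda>_. x) (map_side (replace_atoms x) R))"

definition min_atom :: "game \<Rightarrow> real" where
  "min_atom G = Min (atoms G)"

definition max_atom :: "game \<Rightarrow> real" where
  "max_atom G = Max (atoms G)"

definition game_min :: "game \<Rightarrow> game" where
  "game_min G = replace_atoms (min_atom G) G"

definition game_max :: "game \<Rightarrow> game" where
  "game_max G = replace_atoms (max_atom G) G"

end

theory Submission
  imports Defs
begin

text \<open>
  Let \<open>M\<close> bound the atoms of \<open>G\<close> from above, let \<open>n \<ge> b(G)\<close>, and write \<open>W\<close> for \<open>M\<close> plus \<open>n\<close> waiting
  moves for Left. In a sum with a guaranteed game \<open>X\<close>, Left does at least as well with \<open>W\<close> as with
  \<open>G\<close>: a Left move in \<open>G\<close> is matched by a waiting move, and Right has no move in \<open>W\<close>. If \<open>G\<close> and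
  \<open>X\<close> are left-atomic, waiting moves left over do no harm, because the left atom of \<open>X\<close> is its
  smallest atom; if \<open>X\<close> is right-atomic with atom \<open>x\<close>, Right ends the game at \<open>M + x\<close>, which bounds
  every score of \<open>G + X\<close>. The comparison with the projection of \<open>G\<close> onto \<open>M\<close> holds move by
  move, and the lower bounds follow by conjugation.
\<close>

section \<open>Options of a sum\<close>

text \<open>The doubly atomic case needs no exception here: both option sets are then empty, and so
  is the union.\<close>

lemma lopts_game_add:
  "lopts (G \<oplus> H) = (\<lambda>K. K \<oplus> H) |`| lopts G |\<union>| (\<lambda>K. G \<oplus> K) |`| lopts H"
  by (subst game_add.simps) (auto simp: lopts_def split: side.splits)

lemma ropts_game_add:
  "ropts (G \<oplus> H) = (\<lambda>K. K \<oplus> H) |`| ropts G |\<union>| (\<lambda>K. G \<oplus> K) |`| ropts H"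
  by (subst game_add.simps) (auto simp: ropts_def split: side.splits)

lemma lside_game_add_eq_Atom_iff:
  "lside (G \<oplus> H) = Atom c \<longleftrightarrow> (\<exists>a b. lside G = Atom a \<and> lside H = Atom b \<and> c = a + b)"
  by (subst game_add.simps) (auto split: side.splits)

lemma rside_game_add_eq_Atom_iff:
  "rside (G \<oplus> H) = Atom c \<longleftrightarrow> (\<exists>a b. rside G = Atom a \<and> rside H = Atom b \<and> c = a + b)"
  by (subst game_add.simps) (auto split: side.splits)

lemma lside_game_add_nonempty:
  assumes "lside G \<noteq> Options {||}" "lside H \<noteq> Options {||}"
  shows "lside (G \<oplus> H) \<noteq> Options {||}"
  using assms by (subst game_add.simps) (auto simp: lopts_def split: side.splits)

lemma rside_game_add_nonempty:
  assumes "rside G \<noteq> Options {||}" "rside H \<noteq> Options {||}"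
  shows "rside (G \<oplus> H) \<noteq> Options {||}"
  using assms by (subst game_add.simps) (auto simp: ropts_def split: side.splits)


section \<open>Stops\<close>

lemma Ls_atom: "lside G = Atom l \<Longrightarrow> Ls G = l"
  by (simp add: Ls.simps)

lemma Rs_atom: "rside G = Atom r \<Longrightarrow> Rs G = r"
  by (simp add: Rs.simps)

lemma Rs_option_le_Ls: "K |\<in>| lopts G \<Longrightarrow> Rs K \<le> Ls G"
  by (cases "lside G") (auto simp: lopts_def Ls.simps[of G] intro: Max_ge)

lemma Rs_le_Ls_option: "K |\<in>| ropts G \<Longrightarrow> Rs G \<le> Ls K"
  by (cases "rside G") (auto simp: ropts_def Rs.simps[of G] intro: Min_le)

text \<open>\<open>Max\<close> of the empty set is unspecified, so \<open>Options {||}\<close> has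
  to be excluded; a left-atomic game is covered by the clause for \<open>l\<close>.\<close>

lemma Ls_leI:
  assumes "lside G \<noteq> Options {||}"
    and "\<And>l. lside G = Atom l \<Longrightarrow> l \<le> c" and "\<And>K. K |\<in>| lopts G \<Longrightarrow> Rs K \<le> c"
  shows "Ls G \<le> c"
  using assms by (cases "lside G") (auto simp: lopts_def Ls.simps[of G] intro!: Max.boundedI)

lemma Rs_geI:
  assumes "rside G \<noteq> Options {||}"
    and "\<And>r. rside G = Atom r \<Longrightarrow> c \<le> r" and "\<And>K. K |\<in>| ropts G \<Longrightarrow> c \<le> Ls K"
  shows "c \<le> Rs G"
  using assms by (cases "rside G") (auto simp: ropts_def Rs.simps[of G] intro!: Min.boundedI)

text \<open>Splits Left's turn in a sum into its three cases: the game ends, a move in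
  \<open>G\<close>, a move in \<open>H\<close>. The comparison proofs find an answer in each case
  and never evaluate a maximum.\<close>

lemma Ls_game_add_leI:
  assumes "lside G \<noteq> Options {||}" "lside H \<noteq> Options {||}"
    and "\<And>a b. lside G = Atom a \<Longrightarrow> lside H = Atom b \<Longrightarrow> a + b \<le> c"
    and "\<And>K. K |\<in>| lopts G \<Longrightarrow> Rs (K \<oplus> H) \<le> c"
    and "\<And>K. K |\<in>| lopts H \<Longrightarrow> Rs (G \<oplus> K) \<le> c"
  shows "Ls (G \<oplus> H) \<le> c"
  by (rule Ls_leI)
    (use assms in \<open>auto simp: lside_game_add_nonempty lside_game_add_eq_Atom_iff lopts_game_add\<close>)

lemma Rs_game_add_geI:
  assumes "rside G \<noteq> Options {||}" "rside H \<noteq> Options {||}"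
    and "\<And>a b. rside G = Atom a \<Longrightarrow> rside H = Atom b \<Longrightarrow> c \<le> a + b"
    and "\<And>K. K |\<in>| ropts G \<Longrightarrow> c \<le> Ls (K \<oplus> H)"
    and "\<And>K. K |\<in>| ropts H \<Longrightarrow> c \<le> Ls (G \<oplus> K)"
  shows "c \<le> Rs (G \<oplus> H)"
  by (rule Rs_geI)
    (use assms in \<open>auto simp: rside_game_add_nonempty rside_game_add_eq_Atom_iff ropts_game_add\<close>)

lemma Rs_add_lopt_le_Ls:
  "K |\<in>| lopts G \<Longrightarrow> Rs (K \<oplus> H) \<le> Ls (G \<oplus> H)"
  "K |\<in>| lopts H \<Longrightarrow> Rs (G \<oplus> K) \<le> Ls (G \<oplus> H)"
  by (auto intro!: Rs_option_le_Ls simp: lopts_game_add)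

lemma Rs_le_Ls_add_ropt:
  "K |\<in>| ropts G \<Longrightarrow> Rs (G \<oplus> H) \<le> Ls (K \<oplus> H)"
  "K |\<in>| ropts H \<Longrightarrow> Rs (G \<oplus> H) \<le> Ls (G \<oplus> K)"
  by (auto intro!: Rs_le_Ls_option simp: ropts_game_add)


section \<open>Followers and atoms\<close>

lemma follower_trans: "follower K H \<Longrightarrow> follower G K \<Longrightarrow> follower G H"
  by (induction rule: follower.induct) (auto intro: follower.intros)

lemma follower_option: "K |\<in>| lopts G |\<union>| ropts G \<Longrightarrow> follower G K"
  by (auto intro: follower.intros)

text \<open>The inductive definition extends a line of play at its far end; this form splits off its
  first move, as recursion over options requires.\<close>

lemma follower_iff:
  "follower G H \<longleftrightarrow> H = G \<or> (\<exists>K. K |\<in>| lopts G |\<union>| ropts G \<and> follower K H)"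
proof
  assume "follower G H"
  then show "H = G \<or> (\<exists>K. K |\<in>| lopts G |\<union>| ropts G \<and> follower K H)"
    by induction (auto intro: follower.intros)
qed (auto intro: follower.follower_refl follower_trans follower_option)

section \<open>Properties inherited by options\<close>

lemma well_formed_option: "well_formed G \<Longrightarrow> K |\<in>| lopts G |\<union>| ropts G \<Longrightarrow> well_formed K"
  unfolding well_formed_def by (metis follower_trans follower_option)

lemma atoms_option: "K |\<in>| lopts G |\<union>| ropts G \<Longrightarrow> s \<in> atoms K \<Longrightarrow> s \<in> atoms G"
  unfolding atoms_def mem_Collect_eq by (metis follower_trans follower_option)

lemma guaranteed_option: "guaranteed G \<Longrightarrow> K |\<in>| lopts G |\<union>| ropts G \<Longrightarrow> guaranteed K"
  unfolding guaranteed_def by (meson follower_trans follower_option)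

lemma GS_option: "G \<in> GS \<Longrightarrow> K |\<in>| lopts G |\<union>| ropts G \<Longrightarrow> K \<in> GS"
  unfolding GS_def using well_formed_option guaranteed_option by blast

lemma well_formed_sides:
  "well_formed G \<Longrightarrow> lside G \<noteq> Options {||}" "well_formed G \<Longrightarrow> rside G \<noteq> Options {||}"
  unfolding well_formed_def by (auto intro: follower.intros)

lemma atoms_sides:
  "lside G = Atom s \<Longrightarrow> s \<in> atoms G" "rside G = Atom s \<Longrightarrow> s \<in> atoms G"
  unfolding atoms_def by (auto intro: follower.intros)

lemma guaranteed_lside: "guaranteed G \<Longrightarrow> lside G = Atom l \<Longrightarrow> s \<in> atoms G \<Longrightarrow> l \<le> s"
  unfolding guaranteed_def by (auto intro: follower.intros)

lemma guaranteed_rside: "guaranteed G \<Longrightarrow> rside G = Atom r \<Longrightarrow> s \<in> atoms G \<Longrightarrow> s \<le> r"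
  unfolding guaranteed_def by (auto intro: follower.intros)

lemma well_formed_iff:
  "well_formed G \<longleftrightarrow> lside G \<noteq> Options {||} \<and> rside G \<noteq> Options {||} \<and>
    (\<forall>K. K |\<in>| lopts G |\<union>| ropts G \<longrightarrow> well_formed K)"
  unfolding well_formed_def by (subst follower_iff) blast

section \<open>Followers, atoms and stops of sums\<close>

lemma follower_game_addE:
  assumes "follower (G \<oplus> H) K"
  obtains A B where "K = A \<oplus> B" "follower G A" "follower H B"
proof -
  from assms have "\<exists>A B. K = A \<oplus> B \<and> follower G A \<and> follower H B"
    by (induction; fastforce simp: lopts_game_add ropts_game_add intro: follower.intros)
  with that show thesis by blast
qed

lemma well_formed_game_add: "well_formed G \<Longrightarrow> well_formed H \<Longrightarrow> well_formed (G \<oplus> H)"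
  unfolding well_formed_def
  by (auto elim!: follower_game_addE dest: lside_game_add_nonempty rside_game_add_nonempty)

text \<open>A side of a sum is an atom only where both summands have an atom on that side, and then
  the two values add.\<close>

lemma atoms_game_addE:
  assumes "s \<in> atoms (G \<oplus> H)"
  obtains a b where "s = a + b" "a \<in> atoms G" "b \<in> atoms H"
proof -
  obtain A B where "follower G A" "follower H B"
    and "lside (A \<oplus> B) = Atom s \<or> rside (A \<oplus> B) = Atom s"
    using assms by (auto simp: atoms_def elim!: follower_game_addE)
  then have "\<exists>a b. s = a + b \<and> a \<in> atoms G \<and> b \<in> atoms H"
    unfolding atoms_def lside_game_add_eq_Atom_iff rside_game_add_eq_Atom_iff by blast
  with that show thesis by blast
qed

text \<open>In a well-formed game every maximum and minimum is over a finite nonempty set and hence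
  attained, so optimal play ends at an actual atom. Bounds on atoms thereby become bounds on
  stops.\<close>

lemma stops_in_atoms: "well_formed G \<Longrightarrow> Ls G \<in> atoms G \<and> Rs G \<in> atoms G"
proof (induction "size G" arbitrary: G rule: less_induct)
  case less
  have IH: "Ls K \<in> atoms G" "Rs K \<in> atoms G" if "K |\<in>| lopts G |\<union>| ropts G" for K
    using less that well_formed_option[OF less.prems that] atoms_option[OF that]
    by (auto dest: size_lopts size_ropts)
  have "Ls G \<in> atoms G"
  proof (cases "lside G")
    case (Options A)
    then have "Ls G \<in> Rs ` fset (lopts G)"
      using well_formed_sides(1)[OF less.prems]
      by (auto simp: Ls.simps[of G] lopts_def intro!: Max_in)
    with IH show ?thesis by auto
  qed (simp add: Ls_atom atoms_sides)
  moreover have "Rs G \<in> atoms G"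
  proof (cases "rside G")
    case (Options A)
    then have "Rs G \<in> Ls ` fset (ropts G)"
      using well_formed_sides(2)[OF less.prems]
      by (auto simp: Rs.simps[of G] ropts_def intro!: Min_in)
    with IH show ?thesis by auto
  qed (simp add: Rs_atom atoms_sides)
  ultimately show ?case ..
qed

lemma Rs_game_add_le:
  assumes "well_formed G" "well_formed H" "\<And>s. s \<in> atoms G \<Longrightarrow> s \<le> a" "\<And>s. s \<in> atoms H \<Longrightarrow> s \<le> b"
  shows "Rs (G \<oplus> H) \<le> a + b"
  using stops_in_atoms[OF well_formed_game_add[OF assms(1,2)]] assms(3,4)
  by (metis add_mono atoms_game_addE)

lemma Ls_game_add_ge:
  assumes "well_formed G" "well_formed H" "\<And>s. s \<in> atoms G \<Longrightarrow> a \<le> s" "\<And>s. s \<in> atoms H \<Longrightarrow> b \<le> s"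
  shows "a + b \<le> Ls (G \<oplus> H)"
  using stops_in_atoms[OF well_formed_game_add[OF assms(1,2)]] assms(3,4)
  by (metis add_mono atoms_game_addE)

lemma atoms_iff:
  "s \<in> atoms G \<longleftrightarrow> lside G = Atom s \<or> rside G = Atom s \<or>
    (\<exists>K. K |\<in>| lopts G |\<union>| ropts G \<and> s \<in> atoms K)"
  unfolding atoms_def mem_Collect_eq by (subst follower_iff) blast

text \<open>Makes the \<open>Min\<close> and \<open>Max\<close> in \<open>min_atom\<close> and
  \<open>max_atom\<close> genuine bounds. Each of the finitely many positions contributes at most
  one atom per side.\<close>

lemma finite_atoms: "finite (atoms G)"
proof (induction "size G" arbitrary: G rule: less_induct)
  case less
  have "atoms G = {s. lside G = Atom s} \<union> {s. rside G = Atom s} \<union>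
      (\<Union>K\<in>fset (lopts G |\<union>| ropts G). atoms K)"
    by (auto simp: atoms_iff[of _ G])
  moreover have "finite {s. S = Atom s}" for S :: "game side"
    by (cases S) auto
  moreover have "finite (\<Union>K\<in>fset (lopts G |\<union>| ropts G). atoms K)"
    using less by (auto dest: size_lopts size_ropts)
  ultimately show ?case by simp
qed

lemma atoms_le_max_atom: "s \<in> atoms G \<Longrightarrow> s \<le> max_atom G"
  by (simp add: max_atom_def finite_atoms)

lemma min_atom_le_atoms: "s \<in> atoms G \<Longrightarrow> min_atom G \<le> s"
  by (simp add: min_atom_def finite_atoms)

text \<open>The strict decrease ensures that a waiting move is still available for each Left move in
  \<open>G\<close>.\<close>

lemma birthday_option_less:
  assumes "K |\<in>| lopts G |\<union>| ropts G"
  shows "birthday K < birthday G"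
proof -
  have "birthday K \<le> Max (birthday ` (fset (lopts G) \<union> fset (ropts G)))"
    using assms by (intro Max_ge) auto
  moreover have "\<nexists>l r. G = Game (Atom l) (Atom r)"
    using assms by (auto simp: lopts_def ropts_def)
  ultimately show ?thesis by (simp add: birthday.simps[of G])
qed


section \<open>Conjugation\<close>

lemma lside_conjugate: "lside (conjugate G) = map_atom uminus (map_side conjugate (rside G))"
  by (cases G) simp

lemma rside_conjugate: "rside (conjugate G) = map_atom uminus (map_side conjugate (lside G))"
  by (cases G) simp

lemma lopts_conjugate: "lopts (conjugate G) = conjugate |`| ropts G"
  by (cases "rside G") (auto simp: lopts_def ropts_def lside_conjugate)

lemma ropts_conjugate: "ropts (conjugate G) = conjugate |`| lopts G"
  by (cases "lside G") (auto simp: lopts_def ropts_def rside_conjugate)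

lemma map_atom_eq_Atom_iff: "map_atom f (map_side g S) = Atom s \<longleftrightarrow> (\<exists>t. S = Atom t \<and> s = f t)"
  by (cases S) auto

lemma map_atom_eq_empty_iff: "map_atom f (map_side g S) = Options {||} \<longleftrightarrow> S = Options {||}"
  by (cases S) auto

lemma conjugate_conjugate [simp]: "conjugate (conjugate G) = G"
proof (induction G)
  case (Game L R)
  \<comment> \<open>Stated for an arbitrary side, so that it serves both \<open>L\<close> and
    \<open>R\<close>.\<close>
  have "map_atom uminus (map_side conjugate (map_atom uminus (map_side conjugate S))) = S"
    if "\<And>K. K \<in> set_side S \<Longrightarrow> conjugate (conjugate K) = K" for S
    using that by (cases S) (force simp: fset.map_comp intro: fset.map_ident_strong)+
  with Game show ?case by simp
qed

lemma follower_conjugate: "follower G K \<Longrightarrow> follower (conjugate G) (conjugate K)"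
  by (induction rule: follower.induct)
    (auto intro: follower.intros simp: lopts_conjugate ropts_conjugate)

text \<open>Conjugating once more and cancelling the double conjugation exhibits
  \<open>conjugate H\<close> as the witness.\<close>

lemma follower_conjugateE:
  assumes "follower (conjugate G) H"
  obtains K where "H = conjugate K" "follower G K"
  using follower_conjugate[OF assms] that[of "conjugate H"] by simp

lemma well_formed_conjugate: "well_formed G \<Longrightarrow> well_formed (conjugate G)"
  unfolding well_formed_def
  by (auto elim!: follower_conjugateE simp: lside_conjugate rside_conjugate map_atom_eq_empty_iff)

lemma atoms_conjugate: "s \<in> atoms (conjugate G) \<longleftrightarrow> - s \<in> atoms G"
proof -
  have "- t \<in> atoms K" if t: "t \<in> atoms (conjugate K)" for t K
  proof -
    obtain H where "follower K H"
      and "lside (conjugate H) = Atom t \<or> rside (conjugate H) = Atom t"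
      using t unfolding atoms_def by (blast elim: follower_conjugateE)
    then have "follower K H \<and> (lside H = Atom (- t) \<or> rside H = Atom (- t))"
      by (auto simp: lside_conjugate rside_conjugate map_atom_eq_Atom_iff)
    then show ?thesis unfolding atoms_def by blast
  qed
  \<comment> \<open>Conjugation is an involution, so the converse is the same implication for
    \<open>- s\<close> and \<open>conjugate G\<close>.\<close>
  from this[of s G] this[of "- s" "conjugate G"] show ?thesis by auto
qed

text \<open>Conjugation exchanges the two clauses of the definition, and negating the atoms reverses
  their inequalities.\<close>

lemma guaranteed_conjugate:
  assumes "guaranteed G"
  shows "guaranteed (conjugate G)"
  unfolding guaranteed_def
proof (intro allI impI)
  fix H assume "follower (conjugate G) H"
  then obtain K where K: "H = conjugate K" "follower G K"
    by (rule follower_conjugateE)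
  with assms have "\<forall>l. lside K = Atom l \<longrightarrow> (\<forall>s\<in>atoms K. l \<le> s)"
    "\<forall>r. rside K = Atom r \<longrightarrow> (\<forall>s\<in>atoms K. s \<le> r)"
    unfolding guaranteed_def by auto
  with K show "(\<forall>l. lside H = Atom l \<longrightarrow> (\<forall>s\<in>atoms H. l \<le> s)) \<and>
      (\<forall>r. rside H = Atom r \<longrightarrow> (\<forall>s\<in>atoms H. s \<le> r))"
    by (fastforce simp: lside_conjugate rside_conjugate map_atom_eq_Atom_iff atoms_conjugate)
qed

lemma GS_conjugate: "G \<in> GS \<Longrightarrow> conjugate G \<in> GS"
  by (simp add: GS_def well_formed_conjugate guaranteed_conjugate)

text \<open>\<open>opts\<close> sends both \<open>Atom s\<close> and \<open>Options {||}\<close> to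
  the empty set; the clause about atoms tells them apart.\<close>

lemma side_eqI:
  "(\<And>s. S = Atom s \<longleftrightarrow> T = Atom s) \<Longrightarrow> opts S = opts T \<Longrightarrow> S = T"
  by (cases S; cases T) auto

lemma game_eqI:
  assumes "\<And>s. lside G = Atom s \<longleftrightarrow> lside H = Atom s" "lopts G = lopts H"
    and "\<And>s. rside G = Atom s \<longleftrightarrow> rside H = Atom s" "ropts G = ropts H"
  shows "G = H"
  by (intro game.expand conjI side_eqI) (use assms in \<open>simp_all only: lopts_def ropts_def\<close>)

section \<open>Conjugation of sums, stops, the order and birthdays\<close>

lemma conjugate_game_add: "conjugate (G \<oplus> H) = conjugate G \<oplus> conjugate H"
proof (induction "size G + size H" arbitrary: G H rule: less_induct)
  case less
  have *: "conjugate (K \<oplus> H) = conjugate K \<oplus> conjugate H"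
    if "K |\<in>| lopts G |\<union>| ropts G" for K
    using that by (intro less) (auto dest: size_lopts size_ropts)
  have **: "conjugate (G \<oplus> K) = conjugate G \<oplus> conjugate K"
    if "K |\<in>| lopts H |\<union>| ropts H" for K
    using that by (intro less) (auto dest: size_lopts size_ropts)
  show ?case
  proof (rule game_eqI)
    show "lopts (conjugate (G \<oplus> H)) = lopts (conjugate G \<oplus> conjugate H)"
      using * ** by (simp add: lopts_conjugate lopts_game_add ropts_game_add
          fimage_funion fset.map_comp comp_def cong: fset.map_cong)
    show "ropts (conjugate (G \<oplus> H)) = ropts (conjugate G \<oplus> conjugate H)"
      using * ** by (simp add: ropts_conjugate ropts_game_add lopts_game_add
          fimage_funion fset.map_comp comp_def cong: fset.map_cong)
  qed (auto simp: lside_conjugate rside_conjugate map_atom_eq_Atom_iff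
      lside_game_add_eq_Atom_iff rside_game_add_eq_Atom_iff)
qed

text \<open>Negation turns a minimum into a maximum. Well-formedness keeps both over nonempty sets,
  where this law is available.\<close>

lemma stops_conjugate:
  "well_formed G \<Longrightarrow> Ls (conjugate G) = - Rs G \<and> Rs (conjugate G) = - Ls G"
proof (induction "size G" arbitrary: G rule: less_induct)
  case less
  have IH: "Ls (conjugate K) = - Rs K" "Rs (conjugate K) = - Ls K"
    if "K |\<in>| lopts G |\<union>| ropts G" for K
    using less that well_formed_option[OF less.prems that] by (auto dest: size_lopts size_ropts)
  have "Ls (conjugate G) = - Rs G"
  proof (cases "rside G")
    case (Options A)
    then have "Ls (conjugate G) = Max (Rs ` conjugate ` fset (ropts G))"
      by (simp add: Ls.simps[of "conjugate G"] lside_conjugate lopts_conjugate)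
    also have "Rs ` conjugate ` fset (ropts G) = uminus ` Ls ` fset (ropts G)"
      using IH by (auto simp: image_image)
    also have "Max \<dots> = - Rs G"
      using Options well_formed_sides(2)[OF less.prems]
      by (subst minus_Min_eq_Max[symmetric]) (auto simp: Rs.simps[of G] ropts_def)
    finally show ?thesis .
  qed (simp add: Ls_atom Rs_atom lside_conjugate)
  moreover have "Rs (conjugate G) = - Ls G"
  proof (cases "lside G")
    case (Options A)
    then have "Rs (conjugate G) = Min (Ls ` conjugate ` fset (lopts G))"
      by (simp add: Rs.simps[of "conjugate G"] rside_conjugate ropts_conjugate)
    also have "Ls ` conjugate ` fset (lopts G) = uminus ` Rs ` fset (lopts G)"
      using IH by (auto simp: image_image)
    also have "Min \<dots> = - Ls G"
      using Options well_formed_sides(1)[OF less.prems]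
      by (subst minus_Max_eq_Min[symmetric]) (auto simp: Ls.simps[of G] lopts_def)
    finally show ?thesis .
  qed (simp add: Ls_atom Rs_atom rside_conjugate)
  ultimately show ?case ..
qed

text \<open>Since \<open>GS\<close> is closed under conjugation, \<open>conjugate X\<close> is a
  legitimate test game, and testing with it exchanges and negates the two stops. Every lower bound
  of the theorem is derived from an upper bound in this way.\<close>

lemma game_le_conjugateD:
  assumes "well_formed G" "well_formed H" "conjugate G \<preceq> conjugate H"
  shows "H \<preceq> G"
  unfolding game_ge_def
proof
  fix X assume X: "X \<in> GS"
  have "Ls (conjugate K \<oplus> conjugate X) = - Rs (K \<oplus> X) \<and> Rs (conjugate K \<oplus> conjugate X) = - Ls (K \<oplus> X)"
    if "well_formed K" for K
    using stops_conjugate[of "K \<oplus> X"] that X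
    by (simp add: conjugate_game_add well_formed_game_add GS_def)
  with assms GS_conjugate[OF X]
  show "Ls (H \<oplus> X) \<le> Ls (G \<oplus> X) \<and> Rs (H \<oplus> X) \<le> Rs (G \<oplus> X)"
    unfolding game_ge_def by force
qed

lemma birthday_conjugate: "birthday (conjugate G) = birthday G"
proof (induction "size G" arbitrary: G rule: less_induct)
  case less
  have "birthday ` (fset (lopts (conjugate G)) \<union> fset (ropts (conjugate G))) =
      (\<lambda>K. birthday (conjugate K)) ` (fset (lopts G) \<union> fset (ropts G))"
    by (simp add: lopts_conjugate ropts_conjugate image_Un image_image Un_commute)
  also have "\<dots> = birthday ` (fset (lopts G) \<union> fset (ropts G))"
    using less by (intro image_cong) (auto dest: size_lopts size_ropts)
  finally have "birthday ` (fset (lopts (conjugate G)) \<union> fset (ropts (conjugate G))) =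
      birthday ` (fset (lopts G) \<union> fset (ropts G))" .
  moreover have "(\<exists>l r. conjugate G = Game (Atom l) (Atom r)) \<longleftrightarrow>
      (\<exists>l r. G = Game (Atom l) (Atom r))"
    by (cases G) (auto simp: map_atom_eq_Atom_iff)
  ultimately show ?case by (simp add: birthday.simps[of G] birthday.simps[of "conjugate G"])
qed


section \<open>Replacing atoms\<close>

lemma lside_replace_atoms:
  "lside (replace_atoms x G) =
    map_atom (\<lambda>_. x) (map_side (replace_atoms x) (lside G))"
  by (cases G) simp

lemma rside_replace_atoms:
  "rside (replace_atoms x G) =
    map_atom (\<lambda>_. x) (map_side (replace_atoms x) (rside G))"
  by (cases G) simp

lemma lopts_replace_atoms: "lopts (replace_atoms x G) = replace_atoms x |`| lopts G"
  by (cases "lside G") (auto simp: lopts_def lside_replace_atoms)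

lemma ropts_replace_atoms: "ropts (replace_atoms x G) = replace_atoms x |`| ropts G"
  by (cases "rside G") (auto simp: ropts_def rside_replace_atoms)

lemma well_formed_replace_atoms: "well_formed G \<Longrightarrow> well_formed (replace_atoms x G)"
proof (induction "size G" arbitrary: G rule: less_induct)
  case less
  show ?case
    using less.hyps well_formed_option[OF less.prems] well_formed_sides[OF less.prems]
    by (subst well_formed_iff) (auto simp: lside_replace_atoms rside_replace_atoms
        map_atom_eq_empty_iff lopts_replace_atoms ropts_replace_atoms dest: size_lopts size_ropts)
qed

text \<open>Links projection onto the minimum of \<open>G\<close> with projection of
  \<open>conjugate G\<close> onto an upper bound of its atoms.\<close>

lemma conjugate_replace_atoms: "conjugate (replace_atoms x G) = replace_atoms (- x) (conjugate G)"
proof (induction "size G" arbitrary: G rule: less_induct)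
  case less
  have IH: "conjugate (replace_atoms x K) = replace_atoms (- x) (conjugate K)"
    if "K |\<in>| lopts G |\<union>| ropts G" for K
    using less that by (auto dest: size_lopts size_ropts)
  show ?case
  proof (rule game_eqI)
    show "lopts (conjugate (replace_atoms x G)) = lopts (replace_atoms (- x) (conjugate G))"
      using IH by (simp add: lopts_conjugate lopts_replace_atoms ropts_replace_atoms
          fset.map_comp comp_def cong: fset.map_cong)
    show "ropts (conjugate (replace_atoms x G)) = ropts (replace_atoms (- x) (conjugate G))"
      using IH by (simp add: ropts_conjugate ropts_replace_atoms lopts_replace_atoms
          fset.map_comp comp_def cong: fset.map_cong)
  qed (auto simp: lside_conjugate rside_conjugate lside_replace_atoms rside_replace_atoms
      map_atom_eq_Atom_iff)
qed

text \<open>Both games have the same tree, so each move is copied in the other; only the final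
  scores differ, and replacement raises the contribution of \<open>G\<close> to
  \<open>M\<close>.\<close>

lemma le_replace_atoms:
  assumes "well_formed G" "\<And>s. s \<in> atoms G \<Longrightarrow> s \<le> M"
  shows "G \<preceq> replace_atoms M G"
proof -
  have "Ls (G \<oplus> X) \<le> Ls (replace_atoms M G \<oplus> X) \<and> Rs (G \<oplus> X) \<le> Rs (replace_atoms M G \<oplus> X)"
    if "well_formed X" for X
    using assms that
  proof (induction "size G + size X" arbitrary: G X rule: less_induct)
    case less
    note [simp] = well_formed_sides[OF less.prems(1)] well_formed_sides[OF less.prems(3)]
    have IH1: "Ls (K \<oplus> X) \<le> Ls (replace_atoms M K \<oplus> X)" "Rs (K \<oplus> X) \<le> Rs (replace_atoms M K \<oplus> X)"
      if K: "K |\<in>| lopts G |\<union>| ropts G" for K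
      using less.hyps[of K X] less.prems K well_formed_option[OF _ K] atoms_option[OF K]
      by (auto dest: size_lopts size_ropts)
    have IH2: "Ls (G \<oplus> K) \<le> Ls (replace_atoms M G \<oplus> K)" "Rs (G \<oplus> K) \<le> Rs (replace_atoms M G \<oplus> K)"
      if K: "K |\<in>| lopts X |\<union>| ropts X" for K
      using less.hyps[of G K] less.prems K well_formed_option[OF _ K]
      by (auto dest: size_lopts size_ropts)
    have "Ls (G \<oplus> X) \<le> Ls (replace_atoms M G \<oplus> X)"
    proof (rule Ls_game_add_leI)
      fix a b assume ab: "lside G = Atom a" "lside X = Atom b"
      then have "Ls (replace_atoms M G \<oplus> X) = M + b"
        by (intro Ls_atom) (simp add: lside_game_add_eq_Atom_iff lside_replace_atoms)
      with less.prems(2)[OF atoms_sides(1)[OF ab(1)]]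
      show "a + b \<le> Ls (replace_atoms M G \<oplus> X)" by simp
    next
      fix K assume "K |\<in>| lopts G"
      then show "Rs (K \<oplus> X) \<le> Ls (replace_atoms M G \<oplus> X)"
        by (intro order_trans[OF IH1(2) Rs_add_lopt_le_Ls(1)]) (auto simp: lopts_replace_atoms)
    next
      fix K assume "K |\<in>| lopts X"
      then show "Rs (G \<oplus> K) \<le> Ls (replace_atoms M G \<oplus> X)"
        by (intro order_trans[OF IH2(2) Rs_add_lopt_le_Ls(2)]) auto
    qed simp_all
    moreover have "Rs (G \<oplus> X) \<le> Rs (replace_atoms M G \<oplus> X)"
    proof (rule Rs_game_add_geI)
      fix a b assume "rside (replace_atoms M G) = Atom a" and b: "rside X = Atom b"
      then obtain c where c: "rside G = Atom c" "a = M"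
        by (auto simp: rside_replace_atoms map_atom_eq_Atom_iff)
      with b have "Rs (G \<oplus> X) = c + b"
        by (intro Rs_atom) (simp add: rside_game_add_eq_Atom_iff)
      with less.prems(2)[OF atoms_sides(2)[OF c(1)]] c
      show "Rs (G \<oplus> X) \<le> a + b" by simp
    next
      \<comment> \<open>Every Right move in the projection is the image of a Right move in
        \<open>G\<close>, which Right can play there.\<close>
      fix K assume "K |\<in>| ropts (replace_atoms M G)"
      then obtain H where "H |\<in>| ropts G" "K = replace_atoms M H"
        by (auto simp: ropts_replace_atoms)
      then show "Rs (G \<oplus> X) \<le> Ls (K \<oplus> X)"
        using order_trans[OF Rs_le_Ls_add_ropt(1) IH1(1)] by auto
    next
      fix K assume "K |\<in>| ropts X"
      then show "Rs (G \<oplus> X) \<le> Ls (replace_atoms M G \<oplus> K)"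
        by (intro order_trans[OF Rs_le_Ls_add_ropt(2) IH2(1)]) auto
    qed (simp_all add: rside_replace_atoms map_atom_eq_empty_iff)
    ultimately show ?case ..
  qed
  then show ?thesis by (simp add: game_ge_def GS_def)
qed


section \<open>Waiting moves\<close>

lemma number_sides [simp]:
  "lside (number x) = Atom x" "rside (number x) = Atom x" "lopts (number x) = {||}" "ropts (number x) = {||}"
  by (simp_all add: number_def lopts_def ropts_def)

declare waiting.simps(2) [simp del]

lemma number_add_number: "number x \<oplus> number y = number (x + y)"
  by (rule game_eqI) (auto simp: lside_game_add_eq_Atom_iff rside_game_add_eq_Atom_iff
      lopts_game_add ropts_game_add)

text \<open>\<open>number x\<close> has no options, so the only move uses up one waiting move, and
  Right's atom is \<open>x + 0\<close>.\<close>

lemma number_add_waiting_Suc: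
  "number x \<oplus> waiting (Suc k) = Game (Options {|number x \<oplus> waiting k|}) (Atom x)"
  by (subst game_add.simps) (simp add: waiting.simps lopts_def)

lemma number_add_waiting_sides:
  "lopts (number x \<oplus> waiting (Suc k)) = {|number x \<oplus> waiting k|}"
  "ropts (number x \<oplus> waiting k) = {||}"
  "rside (number x \<oplus> waiting k) = Atom x"
  by (cases k; simp add: number_add_waiting_Suc number_add_number lopts_def ropts_def)+

text \<open>The game tree is a chain of \<open>n\<close> Left moves that ends in
  \<open>number x\<close>.\<close>

lemma birthday_number_add_waiting: "birthday (number x \<oplus> waiting n) = n"
proof (induction n)
  case (Suc n)
  then show ?case
    by (simp add: number_add_waiting_Suc birthday.simps[of "Game _ _"] lopts_def ropts_def)
qed (simp add: number_add_number, simp add: number_def birthday.simps[of "Game _ _"])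

lemma well_formed_number_add_waiting: "well_formed (number x \<oplus> waiting n)"
  by (induction n; subst well_formed_iff)
    (auto simp: number_add_number number_add_waiting_Suc lopts_def ropts_def)

lemma atoms_number_add_waiting: "s \<in> atoms (number x \<oplus> waiting n) \<longleftrightarrow> s = x"
  by (induction n; subst atoms_iff)
    (auto simp: number_add_number number_add_waiting_Suc lopts_def ropts_def)

text \<open>An arbitrary upper bound \<open>M\<close> and \<open>n\<close> at least the birthday,
  rather than the exact values, let the induction pass to an option: its largest atom may be
  smaller, and its birthday may drop by more than one.\<close>

lemma le_number_add_waiting:
  assumes "well_formed G" "\<And>s. s \<in> atoms G \<Longrightarrow> s \<le> M" "birthday G \<le> n"
  shows "G \<preceq> number M \<oplus> waiting n"
proof -
  let ?W = "\<lambda>n. number M \<oplus> waiting n"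
  have "Ls (G \<oplus> X) \<le> Ls (?W n \<oplus> X) \<and> Rs (G \<oplus> X) \<le> Rs (?W n \<oplus> X)" if "X \<in> GS" for X
    using assms that
  proof (induction "size G + size X" arbitrary: G X n rule: less_induct)
    case less
    have wfX: "well_formed X" and gX: "guaranteed X"
      using less.prems by (auto simp: GS_def)
    note [simp] = well_formed_sides[OF less.prems(1)] well_formed_sides[OF wfX]
    have IH: "Ls (G \<oplus> K) \<le> Ls (?W n \<oplus> K)" "Rs (G \<oplus> K) \<le> Rs (?W n \<oplus> K)"
      if K: "K |\<in>| lopts X |\<union>| ropts X" for K
      using less.hyps[of G K n] less.prems K GS_option[OF _ K]
      by (auto dest: size_lopts size_ropts)
    have "Ls (G \<oplus> X) \<le> Ls (?W n \<oplus> X)"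
    proof (rule Ls_game_add_leI)
      fix a b assume ab: "lside G = Atom a" "lside X = Atom b"
      have "a + b \<le> M + b"
        using less.prems(2)[OF atoms_sides(1)[OF ab(1)]] by simp
      \<comment> \<open>\<open>X\<close> is guaranteed, so \<open>b\<close> is its least atom, and
        all atoms of the waiting game equal \<open>M\<close>; the left stop cannot fall below their
        sum even if play continues.\<close>
      also have "\<dots> \<le> Ls (?W n \<oplus> X)"
        using guaranteed_lside[OF gX ab(2)]
        by (intro Ls_game_add_ge well_formed_number_add_waiting wfX)
          (auto simp: atoms_number_add_waiting)
      finally show "a + b \<le> Ls (?W n \<oplus> X)" .
    next
      fix K assume "K |\<in>| lopts G"
      then have K: "K |\<in>| lopts G |\<union>| ropts G" "size K < size G"
        by (auto dest: size_lopts)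
      \<comment> \<open>\<open>G\<close> has an option, so its birthday, and with it
        \<open>n\<close>, is positive: a waiting move is left.\<close>
      with less.prems(3) birthday_option_less[OF K(1)] obtain k where k: "n = Suc k" "birthday K \<le> k"
        by (cases n) auto
      have "Rs (K \<oplus> X) \<le> Rs (?W k \<oplus> X)"
        using less.hyps[of K X k] less.prems K k well_formed_option[OF _ K(1)] atoms_option[OF K(1)]
        by auto
      \<comment> \<open>Left answers the move to \<open>K\<close> by spending one waiting
        move.\<close>
      also have "\<dots> \<le> Ls (?W n \<oplus> X)"
        by (rule Rs_add_lopt_le_Ls) (simp add: k number_add_waiting_sides)
      finally show "Rs (K \<oplus> X) \<le> Ls (?W n \<oplus> X)" .
    next
      fix K assume "K |\<in>| lopts X"
      then show "Rs (G \<oplus> K) \<le> Ls (?W n \<oplus> X)"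
        by (intro order_trans[OF IH(2) Rs_add_lopt_le_Ls(2)]) auto
    qed simp_all
    moreover have "Rs (G \<oplus> X) \<le> Rs (?W n \<oplus> X)"
    proof (rule Rs_game_add_geI)
      fix a b assume "rside (?W n) = Atom a" and "rside X = Atom b"
      then show "Rs (G \<oplus> X) \<le> a + b"
        \<comment> \<open>Here \<open>a\<close> is \<open>M\<close>, and \<open>b\<close> is the
          largest atom of the guaranteed game \<open>X\<close>, so \<open>a + b\<close> bounds every
          final score of \<open>G\<close> plus \<open>X\<close>.\<close>
        using less.prems guaranteed_rside[OF gX] wfX
        by (intro Rs_game_add_le) (auto simp: number_add_waiting_sides)
    next
      fix K assume "K |\<in>| ropts X"
      then show "Rs (G \<oplus> X) \<le> Ls (?W n \<oplus> K)"
        by (intro order_trans[OF Rs_le_Ls_add_ropt(2) IH(1)]) auto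
    \<comment> \<open>The case of a Right move in the waiting game is vacuous.\<close>
    qed (simp_all add: number_add_waiting_sides)
    ultimately show ?case ..
  qed
  then show ?thesis by (simp add: game_ge_def)
qed


section \<open>The upper bounds combined with their conjugates\<close>

theorem theorem18:
  fixes G :: game and n :: nat
  assumes "G \<in> GS" and "n = birthday G"
  shows "(game_min G \<preceq> G \<and> G \<preceq> game_max G) \<and>
    (number (min_atom G) \<oplus> conjugate (waiting n) \<preceq> G \<and>
     G \<preceq> number (max_atom G) \<oplus> waiting n) \<and>
    (birthday (number (min_atom G) \<oplus> conjugate (waiting n)) = n \<and>
     birthday (number (max_atom G) \<oplus> waiting n) = n)"
proof -
  have wf: "well_formed G" "well_formed (conjugate G)"
    using assms(1) by (auto simp: GS_def well_formed_conjugate)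
  \<comment> \<open>Negating the minimum of \<open>G\<close> bounds the atoms of its conjugate from
    above, so both upper bounds apply to \<open>conjugate G\<close> with this value.\<close>
  have atoms_conj: "s \<le> - min_atom G" if "s \<in> atoms (conjugate G)" for s
    using min_atom_le_atoms[of "- s" G] that by (simp add: atoms_conjugate)
  have number_conj: "number (min_atom G) \<oplus> conjugate (waiting n) =
      conjugate (number (- min_atom G) \<oplus> waiting n)"
    by (simp add: conjugate_game_add number_def)
  have "game_min G \<preceq> G"
    by (rule game_le_conjugateD)
      (simp_all add: wf le_replace_atoms[OF wf(2) atoms_conj] game_min_def
        well_formed_replace_atoms conjugate_replace_atoms)
  moreover have "G \<preceq> game_max G"
    unfolding game_max_def by (rule le_replace_atoms[OF wf(1) atoms_le_max_atom])
  moreover have "number (min_atom G) \<oplus> conjugate (waiting n) \<preceq> G"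
    unfolding number_conj
    by (rule game_le_conjugateD)
      (simp_all add: wf le_number_add_waiting[OF wf(2) atoms_conj] assms(2) birthday_conjugate
        well_formed_conjugate well_formed_number_add_waiting)
  moreover have "G \<preceq> number (max_atom G) \<oplus> waiting n"
    using assms(2) by (intro le_number_add_waiting[OF wf(1) atoms_le_max_atom]) auto
  \<comment> \<open>The birthday of the lower bound is that of its conjugate, again a number plus
    \<open>n\<close> waiting moves.\<close>
  ultimately show ?thesis
    by (simp add: number_conj birthday_conjugate birthday_number_add_waiting)
qed

end
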